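(* Let $D$ be the formal derivative on the ring of Laurent polynomials $\mathbb Q[u_1,u_2^{\pm1},u_3,v_1,v_2,t]$ with respect to the grammar $$\{u_1\rightarrow 3tu_2v_2,\ u_2\rightarrow 3tu_2v_1,\ u_3\rightarrow 3tu_2v_2,\ v_1\rightarrow 2(u_1+u_3),\ v_2\rightarrow 4u_1u_2^{-1}u_3,\ t\rightarrow t^2v_1\}.$$ Then for every $n\ge1$, $$D^n(2u_3)=(n+2)!\,M_n(u_1,u_2,u_3;v_1,v_2;t).$$
   Context: A formal derivative with respect to a grammar (substitution rules $z\to f_z$ for variables $z$) is the linear operator $D$ with $D(z)=f_z$, $D(uv)=D(u)v+uD(v)$, $D(c)=0$ for constants. A plane tree is an unlabeled rooted tree in which the children of every vertex are linearly ordered. A leaf is a vertex with no children, an interior vertex one with at least one child. A tip-augmented plane tree is a plane tree in which the leftmost child of every interior vertex is a leaf; $\mathcal T_m$ is the set of tip-augmented plane trees with $m$ edges. In such a tree: a leaf without siblings is a singleton leaf; a leaf with siblings that is the leftmost child of its parent is an elder twin leaf if the second child of its parent is a leaf, and an elder non-twin leaf otherwise; a leaf with siblings that is the second child is a second leaf; a leaf with siblings that is neither first nor second child is a younger leaf. An edge is a young edge if its lower endpoint is not a singleton, elder twin or elder non-twin leaf. Let $\mathrm{sleaf},\mathrm{etleaf},\mathrm{entleaf},\mathrm{syleaf},\mathrm{yerleaf},\mathrm{yedge}$ count singleton, elder twin, elder non-twin, second and younger leaves and young edges. For $n\ge1$, $M_n(u_1,u_2,u_3;v_1,v_2;t)=\sum_{T\in\mathcal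 T_{n+1}}u_1^{\mathrm{sleaf}(T)}u_2^{\mathrm{etleaf}(T)}u_3^{\mathrm{entleaf}(T)}v_1^{\mathrm{yerleaf}(T)}v_2^{\mathrm{syleaf}(T)}t^{\mathrm{yedge}(T)}$. *)

theory Defs
  imports Complex_Main "HOL-Library.Poly_Mapping" "HOL-Library.Product_Plus"
begin

section \<open>Tip-augmented plane trees\<close>

datatype plane_tree = Node (children: "plane_tree list")

definition is_leaf :: "plane_tree \<Rightarrow> bool" where
  "is_leaf T \<longleftrightarrow> children T = []"

fun tip_augmented :: "plane_tree \<Rightarrow> bool" where
  "tip_augmented (Node ts) \<longleftrightarrow>
     (ts \<noteq> [] \<longrightarrow> is_leaf (hd ts)) \<and> (\<forall>s \<in> set ts. tip_augmented s)"

text \<open>A non-root vertex is represented by a pair \<open>ts\<close>, \<open>i\<close>: it is the child number \<open>i\<close>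
  (counted from 0) in the list \<open>ts\<close> of all children of its parent, given as
  subtrees. The function below counts the non-root vertices with a property of
  such pairs. Since every edge is determined by its lower endpoint, it counts edges as well.
  The root is never counted; it is a leaf only in the tree without edges.\<close>

fun count_nonroot :: "(plane_tree list \<Rightarrow> nat \<Rightarrow> bool) \<Rightarrow> plane_tree \<Rightarrow> nat" where
  "count_nonroot P (Node ts) =
     card {i. i < length ts \<and> P ts i} + (\<Sum>s \<leftarrow> ts. count_nonroot P s)"

definition singleton_leaf :: "plane_tree list \<Rightarrow> nat \<Rightarrow> bool" where
  "singleton_leaf ts i \<longleftrightarrow> is_leaf (ts ! i) \<and> length ts = 1"

definition elder_twin_leaf :: "plane_tree list \<Rightarrow> nat \<Rightarrow> bool" where
  "elder_twin_leaf ts i \<longleftrightarrow> is_leaf (ts ! i) \<and> length ts > 1 \<and> i = 0 \<and> is_leaf (ts ! 1)"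

definition elder_nontwin_leaf :: "plane_tree list \<Rightarrow> nat \<Rightarrow> bool" where
  "elder_nontwin_leaf ts i \<longleftrightarrow> is_leaf (ts ! i) \<and> length ts > 1 \<and> i = 0 \<and> \<not> is_leaf (ts ! 1)"

definition second_leaf :: "plane_tree list \<Rightarrow> nat \<Rightarrow> bool" where
  "second_leaf ts i \<longleftrightarrow> is_leaf (ts ! i) \<and> length ts > 1 \<and> i = 1"

definition younger_leaf :: "plane_tree list \<Rightarrow> nat \<Rightarrow> bool" where
  "younger_leaf ts i \<longleftrightarrow> is_leaf (ts ! i) \<and> length ts > 1 \<and> i \<noteq> 0 \<and> i \<noteq> 1"

definition young_edge :: "plane_tree list \<Rightarrow> nat \<Rightarrow> bool" where
  "young_edge ts i \<longleftrightarrow>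
     \<not> (singleton_leaf ts i \<or> elder_twin_leaf ts i \<or> elder_nontwin_leaf ts i)"

definition edges :: "plane_tree \<Rightarrow> nat" where
  "edges = count_nonroot (\<lambda>_ _. True)"

definition sleaf :: "plane_tree \<Rightarrow> nat" where
  "sleaf = count_nonroot singleton_leaf"

definition etleaf :: "plane_tree \<Rightarrow> nat" where
  "etleaf = count_nonroot elder_twin_leaf"

definition entleaf :: "plane_tree \<Rightarrow> nat" where
  "entleaf = count_nonroot elder_nontwin_leaf"

definition syleaf :: "plane_tree \<Rightarrow> nat" where
  "syleaf = count_nonroot second_leaf"

definition yerleaf :: "plane_tree \<Rightarrow> nat" where
  "yerleaf = count_nonroot younger_leaf"

definition yedge :: "plane_tree \<Rightarrow> nat" where
  "yedge = count_nonroot young_edge"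

definition tip_augmented_trees :: "nat \<Rightarrow> plane_tree set" where
  "tip_augmented_trees m = {T. tip_augmented T \<and> edges T = m}"

lemma edges_Node: "edges (Node ts) = length ts + (\<Sum>s \<leftarrow> ts. edges s)"
  by (simp add: edges_def)

lemma finite_edges_le: "finite {T. edges T \<le> m}"
proof (induction m)
  case 0
  have "{T. edges T \<le> 0} \<subseteq> {Node []}"
  proof
    fix T assume "T \<in> {T. edges T \<le> 0}"
    then show "T \<in> {Node []}" by (cases T) (simp add: edges_Node)
  qed
  then show ?case by (rule finite_subset) simp
next
  case (Suc m)
  have "{T. edges T \<le> Suc m} \<subseteq>
      Node ` {ts. set ts \<subseteq> {T. edges T \<le> m} \<and> length ts \<le> Suc m}"
  proof
    fix T assume T: "T \<in> {T. edges T \<le> Suc m}"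
    obtain ts where ts: "T = Node ts" by (cases T)
    have le: "length ts + (\<Sum>s \<leftarrow> ts. edges s) \<le> Suc m"
      using T by (simp add: ts edges_Node)
    have "edges s \<le> m" if s: "s \<in> set ts" for s
    proof -
      have "length ts \<ge> 1" using s by (cases ts) auto
      moreover have "edges s \<le> (\<Sum>s \<leftarrow> ts. edges s)"
        using s by (intro member_le_sum_list) auto
      ultimately show ?thesis using le by linarith
    qed
    then show "T \<in> Node ` {ts. set ts \<subseteq> {T. edges T \<le> m} \<and> length ts \<le> Suc m}"
      using le by (auto simp: ts)
  qed
  then show ?case
    by (rule finite_subset) (intro finite_imageI finite_lists_length_le Suc.IH)
qed

lemma finite_tip_augmented_trees: "finite (tip_augmented_trees m)"
  by (rule finite_subset[OF _ finite_edges_le[of m]]) (auto simp: tip_augmented_trees_def)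

definition M :: "nat \<Rightarrow> 'a \<Rightarrow> 'a \<Rightarrow> 'a \<Rightarrow> 'a \<Rightarrow> 'a \<Rightarrow> 'a \<Rightarrow> 'a::comm_semiring_1" where
  "M n u1 u2 u3 v1 v2 t =
     (\<Sum>T \<in> tip_augmented_trees (n + 1).
        u1 ^ sleaf T * u2 ^ etleaf T * u3 ^ entleaf T *
        v1 ^ yerleaf T * v2 ^ syleaf T * t ^ yedge T)"


section \<open>The ring of Laurent polynomials and the grammar\<close>

text \<open>The ring \<open>\<rat>[u1, u2, inverse u2, u3, v1, v2, t]\<close> is the monoid algebra over the rationals of
  the additive monoid of exponent vectors, listed in the order \<open>u1, u2, u3, v1, v2, t\<close>. Only the
  exponent of \<open>u2\<close> may be negative.\<close>

type_synonym expvec = "nat \<times> int \<times> nat \<times> nat \<times> nat \<times> nat"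
type_synonym laurent = "expvec \<Rightarrow>\<^sub>0 rat"

definition Const :: "rat \<Rightarrow> laurent" where
  "Const c = Poly_Mapping.single 0 c"

definition monomial :: "expvec \<Rightarrow> laurent" where
  "monomial a = Poly_Mapping.single a 1"

definition var_u1 :: laurent where "var_u1 = monomial (1, 0, 0, 0, 0, 0)"
definition var_u2 :: laurent where "var_u2 = monomial (0, 1, 0, 0, 0, 0)"
definition var_u2_inv :: laurent where "var_u2_inv = monomial (0, -1, 0, 0, 0, 0)"
definition var_u3 :: laurent where "var_u3 = monomial (0, 0, 1, 0, 0, 0)"
definition var_v1 :: laurent where "var_v1 = monomial (0, 0, 0, 1, 0, 0)"
definition var_v2 :: laurent where "var_v2 = monomial (0, 0, 0, 0, 1, 0)"
definition var_t :: laurent where "var_t = monomial (0, 0, 0, 0, 0, 1)"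

definition formal_derivative :: "(laurent \<times> laurent) set \<Rightarrow> (laurent \<Rightarrow> laurent) \<Rightarrow> bool" where
  "formal_derivative G D \<longleftrightarrow>
     (\<forall>p q. D (p + q) = D p + D q) \<and>
     (\<forall>c p. D (Const c * p) = Const c * D p) \<and>
     (\<forall>p q. D (p * q) = D p * q + p * D q) \<and>
     (\<forall>c. D (Const c) = 0) \<and>
     (\<forall>(z, f) \<in> G. D z = f)"

definition grammar :: "(laurent \<times> laurent) set" where
  "grammar =
     {(var_u1, 3 * var_t * var_u2 * var_v2),
      (var_u2, 3 * var_t * var_u2 * var_v1),
      (var_u3, 3 * var_t * var_u2 * var_v2),
      (var_v1, 2 * (var_u1 + var_u3)),
      (var_v2, 4 * var_u1 * var_u2_inv * var_u3),
      (var_t, var_t ^ 2 * var_v1)}"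

lemma monomial_add: "monomial (a + b) = monomial a * monomial b"
  by (simp add: monomial_def mult_single)

lemma var_u2_mult_inv: "var_u2 * var_u2_inv = 1"
  by (simp add: var_u2_def var_u2_inv_def flip: monomial_add)
     (simp add: monomial_def flip: zero_prod_def)


subsection \<open>Existence and uniqueness of the formal derivative\<close>

lemma single_eq: "Poly_Mapping.single a c = Const c * monomial a"
  by (simp add: Const_def monomial_def mult_single)

lemma Const_add: "Const (c + d) = Const c + Const d"
  by (simp add: Const_def single_add)

lemma Const_mult: "Const (c * d) = Const c * Const d"
  by (simp add: Const_def mult_single)

lemma laurent_induct [case_names single add]:
  fixes p :: laurent
  assumes single: "\<And>a c. P (Const c * monomial a)"
    and add: "\<And>p q. P p \<Longrightarrow> P q \<Longrightarrow> P (p + q)"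
  shows "P p"
proof -
  have P0: "P 0" using single[of 0 0] by (simp add: Const_def)
  have sum: "P (\<Sum>a \<in> A. Const (Poly_Mapping.lookup p a) * monomial a)" if "finite A" for A
    using that by (induction A) (auto intro: P0 single add)
  have p: "p = (\<Sum>a \<in> Poly_Mapping.keys p. Const (Poly_Mapping.lookup p a) * monomial a)"
    by (rule poly_mapping_eqI)
       (simp add: lookup_sum lookup_single when_def in_keys_iff flip: single_eq)
  show ?thesis by (subst p) (rule sum[OF finite_keys])
qed

text \<open>The value of the derivative on a monomial. The truncated subtraction is harmless, because
  the corresponding coefficient vanishes if the exponent is 0.\<close>

fun deriv_monomial :: "expvec \<Rightarrow> laurent" where
  "deriv_monomial (i, j, k, l, m, r) =
     of_nat i * monomial (i - 1, j, k, l, m, r) * (3 * var_t * var_u2 * var_v2) +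
     of_int j * monomial (i, j - 1, k, l, m, r) * (3 * var_t * var_u2 * var_v1) +
     of_nat k * monomial (i, j, k - 1, l, m, r) * (3 * var_t * var_u2 * var_v2) +
     of_nat l * monomial (i, j, k, l - 1, m, r) * (2 * (var_u1 + var_u3)) +
     of_nat m * monomial (i, j, k, l, m - 1, r) * (4 * var_u1 * var_u2_inv * var_u3) +
     of_nat r * monomial (i, j, k, l, m, r - 1) * (var_t ^ 2 * var_v1)"

definition laurent_deriv :: "laurent \<Rightarrow> laurent" where
  "laurent_deriv p =
     (\<Sum>a \<in> Poly_Mapping.keys p. Const (Poly_Mapping.lookup p a) * deriv_monomial a)"

lemma distrib_shift:
  fixes F :: laurent
  assumes "F = p * q'" "F = p' * q"
  shows "(c + d) * F = c * p * q' + p' * (d * q)"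
proof -
  have "c * F = c * p * q'" unfolding assms(1) by (simp only: mult.assoc)
  moreover have "d * F = p' * (d * q)" unfolding assms(2) by (rule mult.left_commute)
  ultimately show ?thesis by (simp only: distrib_right)
qed

lemma nat_shift:
  assumes "\<And>x y. F (x + y) = f x * g y" "\<And>x y. F (x + y) = g' x * f' y"
    "\<And>x. f x = g' x" "\<And>y. f' y = g y"
  shows "of_nat (x + y) * F (x + y - 1) =
     (of_nat x * f (x - 1) * g y + g' x * (of_nat y * f' (y - 1)) :: laurent)"
proof (cases "x = 0 \<or> y = 0")
  case True
  then show ?thesis
  proof
    assume x: "x = 0"
    show ?thesis
      using assms(2)[of 0 "y - 1"] by (simp add: x mult_ac)
  next
    assume y: "y = 0"
    show ?thesis
      using assms(1)[of "x - 1" 0] by (simp add: y mult_ac)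
  qed
next
  case False
  then have "x + y - 1 = (x - 1) + y" "x + y - 1 = x + (y - 1)" by auto
  then have "F (x + y - 1) = f (x - 1) * g y" "F (x + y - 1) = g' x * f' (y - 1)"
    using assms(1)[of "x - 1" y] assms(2)[of x "y - 1"] by metis+
  then show ?thesis unfolding of_nat_add by (rule distrib_shift)
qed

lemma deriv_monomial_add:
  "deriv_monomial (a + b) = deriv_monomial a * monomial b + monomial a * deriv_monomial b"
proof -
  obtain i j k l m r where a: "a = (i, j, k, l, m, r)" by (cases a)
  obtain i' j' k' l' m' r' where b: "b = (i', j', k', l', m', r')" by (cases b)
  note mm = monomial_add[symmetric]
  have 1: "of_nat (i + i') * monomial (i + i' - 1, j + j', k + k', l + l', m + m', r + r') =
      of_nat i * monomial (i - 1, j, k, l, m, r) * monomial b +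
      monomial a * (of_nat i' * monomial (i' - 1, j', k', l', m', r'))"
    unfolding a b by (rule nat_shift) (simp_all add: mm)
  have 2: "of_int (j + j') * monomial (i + i', j + j' - 1, k + k', l + l', m + m', r + r') =
      of_int j * monomial (i, j - 1, k, l, m, r) * monomial b +
      monomial a * (of_int j' * monomial (i', j' - 1, k', l', m', r'))"
  proof -
    have "monomial (i, j - 1, k, l, m, r) * monomial b =
        monomial (i + i', j + j' - 1, k + k', l + l', m + m', r + r')"
      "monomial a * monomial (i', j' - 1, k', l', m', r') =
        monomial (i + i', j + j' - 1, k + k', l + l', m + m', r + r')"
      unfolding a b mm by (simp_all add: algebra_simps)
    then show ?thesis unfolding of_int_add by (intro distrib_shift) (simp_all only:)
  qed
  have 3: "of_nat (k + k') * monomial (i + i', j + j', k + k' - 1, l + l', m + m', r + r') =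
      of_nat k * monomial (i, j, k - 1, l, m, r) * monomial b +
      monomial a * (of_nat k' * monomial (i', j', k' - 1, l', m', r'))"
    unfolding a b by (rule nat_shift) (simp_all add: mm)
  have 4: "of_nat (l + l') * monomial (i + i', j + j', k + k', l + l' - 1, m + m', r + r') =
      of_nat l * monomial (i, j, k, l - 1, m, r) * monomial b +
      monomial a * (of_nat l' * monomial (i', j', k', l' - 1, m', r'))"
    unfolding a b by (rule nat_shift) (simp_all add: mm)
  have 5: "of_nat (m + m') * monomial (i + i', j + j', k + k', l + l', m + m' - 1, r + r') =
      of_nat m * monomial (i, j, k, l, m - 1, r) * monomial b +
      monomial a * (of_nat m' * monomial (i', j', k', l', m' - 1, r'))"
    unfolding a b by (rule nat_shift) (simp_all add: mm)
  have 6: "of_nat (r + r') * monomial (i + i', j + j', k + k', l + l', m + m', r + r' - 1) =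
      of_nat r * monomial (i, j, k, l, m, r - 1) * monomial b +
      monomial a * (of_nat r' * monomial (i', j', k', l', m', r' - 1))"
    unfolding a b by (rule nat_shift) (simp_all add: mm)
  have "a + b = (i + i', j + j', k + k', l + l', m + m', r + r')" by (simp add: a b)
  then have "deriv_monomial (a + b) =
      deriv_monomial (i + i', j + j', k + k', l + l', m + m', r + r')" by simp
  also have "\<dots> = deriv_monomial (i, j, k, l, m, r) * monomial b +
      monomial a * deriv_monomial (i', j', k', l', m', r')"
    unfolding deriv_monomial.simps 1 2 3 4 5 6 by (simp only: distrib_left distrib_right ac_simps)
  finally show ?thesis by (simp only: a b)
qed

lemma laurent_deriv_superset:
  assumes "finite A" "Poly_Mapping.keys p \<subseteq> A"
  shows "laurent_deriv p = (\<Sum>a \<in> A. Const (Poly_Mapping.lookup p a) * deriv_monomial a)"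
  unfolding laurent_deriv_def
  by (rule sum.mono_neutral_left) (use assms in \<open>auto simp: in_keys_iff Const_def\<close>)

lemma laurent_deriv_add: "laurent_deriv (p + q) = laurent_deriv p + laurent_deriv q"
proof -
  let ?A = "Poly_Mapping.keys p \<union> Poly_Mapping.keys q"
  have "Poly_Mapping.keys (p + q) \<subseteq> ?A" by (rule keys_add)
  then show ?thesis
    by (simp add: laurent_deriv_superset[of ?A] lookup_add Const_add distrib_right
        sum.distrib)
qed

lemma laurent_deriv_single: "laurent_deriv (Const c * monomial a) = Const c * deriv_monomial a"
  by (subst laurent_deriv_superset[of "{a}"]) (auto simp flip: single_eq)

lemma deriv_monomial_0: "deriv_monomial 0 = 0"
  by (simp add: zero_prod_def)

lemma monomial_0: "monomial 0 = 1"
  by (simp add: monomial_def)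

lemma Const_1: "Const 1 = 1"
  by (simp add: Const_def)

lemma laurent_deriv_monomial: "laurent_deriv (monomial a) = deriv_monomial a"
  using laurent_deriv_single[of 1 a] by (simp add: Const_1)

lemma laurent_deriv_Const: "laurent_deriv (Const c) = 0"
  using laurent_deriv_single[of c 0] by (simp add: monomial_0 deriv_monomial_0)

lemma laurent_deriv_mult: "laurent_deriv (p * q) = laurent_deriv p * q + p * laurent_deriv q"
proof (induction p rule: laurent_induct)
  case (single a c)
  show ?case
  proof (induction q rule: laurent_induct)
    case (single b d)
    have "(Const c * monomial a) * (Const d * monomial b) = Const (c * d) * monomial (a + b)"
      by (simp add: Const_mult monomial_add ac_simps)
    then have "laurent_deriv ((Const c * monomial a) * (Const d * monomial b)) =
        Const (c * d) * (deriv_monomial a * monomial b + monomial a * deriv_monomial b)"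
      by (simp only: laurent_deriv_single deriv_monomial_add)
    also have "\<dots> = (Const c * deriv_monomial a) * (Const d * monomial b) +
        (Const c * monomial a) * (Const d * deriv_monomial b)"
      by (simp only: Const_mult distrib_left ac_simps)
    finally show ?case by (simp only: laurent_deriv_single)
  next
    case (add q q')
    then show ?case by (simp only: laurent_deriv_add distrib_left distrib_right ac_simps)
  qed
next
  case (add p p')
  then show ?case by (simp only: laurent_deriv_add distrib_left distrib_right ac_simps)
qed

lemma laurent_deriv_var:
  "laurent_deriv var_u1 = 3 * var_t * var_u2 * var_v2"
  "laurent_deriv var_u2 = 3 * var_t * var_u2 * var_v1"
  "laurent_deriv var_u3 = 3 * var_t * var_u2 * var_v2"
  "laurent_deriv var_v1 = 2 * (var_u1 + var_u3)"
  "laurent_deriv var_v2 = 4 * var_u1 * var_u2_inv * var_u3"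
  "laurent_deriv var_t = var_t ^ 2 * var_v1"
proof -
  have 1: "monomial (0, 0, 0, 0, 0, 0) = 1" using monomial_0 by (simp add: zero_prod_def)
  show "laurent_deriv var_u1 = 3 * var_t * var_u2 * var_v2"
    unfolding var_u1_def laurent_deriv_monomial by (simp add: 1)
  show "laurent_deriv var_u2 = 3 * var_t * var_u2 * var_v1"
    by (subst var_u2_def) (simp add: laurent_deriv_monomial 1)
  show "laurent_deriv var_u3 = 3 * var_t * var_u2 * var_v2"
    by (subst var_u3_def) (simp add: laurent_deriv_monomial 1)
  show "laurent_deriv var_v1 = 2 * (var_u1 + var_u3)"
    by (subst var_v1_def) (simp add: laurent_deriv_monomial 1)
  show "laurent_deriv var_v2 = 4 * var_u1 * var_u2_inv * var_u3"
    by (subst var_v2_def) (simp add: laurent_deriv_monomial 1)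
  show "laurent_deriv var_t = var_t ^ 2 * var_v1"
    by (subst var_t_def) (simp add: laurent_deriv_monomial 1)
qed

lemma formal_derivative_laurent_deriv: "formal_derivative grammar laurent_deriv"
  unfolding formal_derivative_def grammar_def
  by (simp add: laurent_deriv_add laurent_deriv_mult laurent_deriv_Const laurent_deriv_var)

lemma formal_derivative_unique:
  assumes D: "formal_derivative grammar D" and E: "formal_derivative grammar E"
  shows "D = E"
proof
  have mult: "D (p * q) = D p * q + p * D q" "E (p * q) = E p * q + p * E q" for p q
    using D E by (auto simp: formal_derivative_def)
  have one: "D 1 = 0" "E 1 = 0"
    using D E by (auto simp: formal_derivative_def simp flip: Const_1)
  have gen: "D z = E z"
    if "z \<in> {var_u1, var_u2, var_u3, var_v1, var_v2, var_t}" for z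
    using D E that unfolding formal_derivative_def grammar_def by auto
  have inv: "D var_u2_inv = E var_u2_inv"
  proof -
    have "D var_u2 * var_u2_inv + var_u2 * D var_u2_inv =
        E var_u2 * var_u2_inv + var_u2 * E var_u2_inv"
      using mult[of var_u2 var_u2_inv] by (simp only: var_u2_mult_inv one)
    then have "var_u2 * D var_u2_inv = var_u2 * E var_u2_inv"
      using gen[of var_u2] by simp
    then have "(var_u2 * var_u2_inv) * D var_u2_inv = (var_u2 * var_u2_inv) * E var_u2_inv"
      by (simp only: mult.assoc mult.left_commute[of var_u2])
    then show ?thesis by (simp add: var_u2_mult_inv)
  qed
  have pow: "D (z ^ n) = E (z ^ n)" if "D z = E z" for z n
    by (induction n) (simp_all add: one mult that)
  have gen_pow: "D (z ^ n) = E (z ^ n)"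
    if "z \<in> {var_u1, var_u2, var_u3, var_v1, var_v2, var_t}" for z n
    using that by (intro pow gen)
  have times: "D (p * q) = E (p * q)" if "D p = E p" "D q = E q" for p q
    using that by (simp add: mult)
  have mpow: "monomial (n * i, int n * j, n * k, n * l, n * m, n * r) =
      monomial (i, j, k, l, m, r) ^ n" for n i j k l m r
  proof (induction n)
    case 0
    then show ?case using monomial_0 by (simp add: zero_prod_def)
  next
    case (Suc n)
    have "monomial (Suc n * i, int (Suc n) * j, Suc n * k, Suc n * l, Suc n * m, Suc n * r) =
        monomial (i, j, k, l, m, r) * monomial (n * i, int n * j, n * k, n * l, n * m, n * r)"
      by (simp add: monomial_add[symmetric] distrib_right)
    then show ?case by (simp only: Suc.IH power_Suc)
  qed
  have mon: "D (monomial a) = E (monomial a)" for a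
  proof -
    obtain i j k l m r where a: "a = (i, j, k, l, m, r)" by (cases a)
    have "monomial (0, j, 0, 0, 0, 0) = (if j \<ge> 0 then var_u2 ^ nat j else var_u2_inv ^ nat (- j))"
      using mpow[of "nat j" 0 1 0 0 0 0] mpow[of "nat (- j)" 0 "-1" 0 0 0 0]
      by (auto simp: var_u2_def var_u2_inv_def)
    moreover have "monomial a = monomial (i * 1, int i * 0, i * 0, i * 0, i * 0, i * 0) *
        monomial (0, j, 0, 0, 0, 0) *
        monomial (k * 0, int k * 0, k * 1, k * 0, k * 0, k * 0) *
        monomial (l * 0, int l * 0, l * 0, l * 1, l * 0, l * 0) *
        monomial (m * 0, int m * 0, m * 0, m * 0, m * 1, m * 0) *
        monomial (r * 0, int r * 0, r * 0, r * 0, r * 0, r * 1)"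
      by (simp add: a monomial_add[symmetric])
    ultimately have "monomial a = var_u1 ^ i *
        (if j \<ge> 0 then var_u2 ^ nat j else var_u2_inv ^ nat (- j)) *
        var_u3 ^ k * var_v1 ^ l * var_v2 ^ m * var_t ^ r"
      unfolding mpow var_u1_def[symmetric] var_u3_def[symmetric] var_v1_def[symmetric]
        var_v2_def[symmetric] var_t_def[symmetric] by simp
    moreover have
      "D (if j \<ge> 0 then var_u2 ^ nat j else var_u2_inv ^ nat (- j)) =
       E (if j \<ge> 0 then var_u2 ^ nat j else var_u2_inv ^ nat (- j))"
      by (cases "j \<ge> 0") (simp_all add: pow inv gen)
    ultimately show ?thesis
      by (simp only:) (intro times gen_pow; (assumption | simp))
  qed
  have scale: "D (Const c * q) = Const c * D q" "E (Const c * q) = Const c * E q"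
    and plus: "D (q + q') = D q + D q'" "E (q + q') = E q + E q'" for c q q'
    using D E unfolding formal_derivative_def by blast+
  fix p
  show "D p = E p"
    by (induction p rule: laurent_induct) (simp_all only: scale plus mon)
qed

end

theory Submission
  imports Defs "HOL-Computational_Algebra.Formal_Power_Series"
begin

text \<open>Splitting off the root gives a quadratic equation \<open>Q = 0\<close> for the generating function \<open>A\<close> of
  the interior trees by number of edges, with coefficients in the polynomials in the variables and
  \<open>X\<close>. Extend \<open>D\<close> coefficientwise to power series. Modulo \<open>Q\<close>, applying the derivation
  \<open>D - d/dX\<close> to the equation yields \<open>D A = A' + A / X - 2 u1\<close>, since the cofactor \<open>\<partial>Q/\<partial>A\<close> has constant
  term \<open>-1\<close> and is invertible. Coefficientwise this says \<open>D M\<^sub>n = (n + 3) M\<^sub>n\<^sub>+\<^sub>1\<close> for all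
  \<open>n \<ge> 0\<close>, where \<open>M\<^sub>0 = u1\<close>. The induction starts because \<open>D u3 = D u1\<close>.\<close>

unbundle fps_syntax

section \<open>Weighted generating functions\<close>

text \<open>A sum over an infinite fibre of \<open>sz\<close> is 0 by convention, so the rules below
  for unions and products assume finite fibres.\<close>

definition gf :: "('b \<Rightarrow> nat) \<Rightarrow> ('b \<Rightarrow> 'a::comm_semiring_1) \<Rightarrow> 'b set \<Rightarrow> 'a fps" where
  "gf sz w S = Abs_fps (\<lambda>n. \<Sum>x | x \<in> S \<and> sz x = n. w x)"

lemma gf_nth: "gf sz w S $ n = (\<Sum>x | x \<in> S \<and> sz x = n. w x)"
  by (simp add: gf_def)

lemma gf_cong:
  assumes "\<And>x. x \<in> S \<Longrightarrow> sz x = sz' x" "\<And>x. x \<in> S \<Longrightarrow> w x = w' x"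
  shows "gf sz w S = gf sz' w' S"
  by (rule fps_ext, unfold gf_nth, rule sum.cong) (auto simp: assms)

lemma gf_Un:
  assumes "\<And>n. finite {x. x \<in> S \<and> sz x = n}" "\<And>n. finite {x. x \<in> S' \<and> sz x = n}"
    and "S \<inter> S' = {}"
  shows "gf sz w (S \<union> S') = gf sz w S + gf sz w S'"
proof (rule fps_ext)
  fix n
  have "{x. x \<in> S \<union> S' \<and> sz x = n} = {x. x \<in> S \<and> sz x = n} \<union> {x. x \<in> S' \<and> sz x = n}"
    by auto
  then show "gf sz w (S \<union> S') $ n = (gf sz w S + gf sz w S') $ n"
    unfolding gf_nth fps_add_nth by (simp only:) (rule sum.union_disjoint, use assms in auto)
qed

lemma gf_singleton: "gf sz w {x} = fps_const (w x) * fps_X ^ sz x"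
proof (rule fps_ext)
  fix n
  have "{y. y \<in> {x} \<and> sz y = n} = (if sz x = n then {x} else {})" by auto
  then show "gf sz w {x} $ n = (fps_const (w x) * fps_X ^ sz x) $ n"
    unfolding gf_nth by (simp only:) (auto simp: fps_X_power_nth)
qed

lemma gf_image:
  assumes "inj_on f S"
  shows "gf sz w (f ` S) = gf (\<lambda>x. sz (f x)) (\<lambda>x. w (f x)) S"
proof (rule fps_ext)
  fix n
  have "{y. y \<in> f ` S \<and> sz y = n} = f ` {x. x \<in> S \<and> sz (f x) = n}" by auto
  moreover have "inj_on f {x. x \<in> S \<and> sz (f x) = n}" using assms by (rule inj_on_subset) auto
  ultimately show "gf sz w (f ` S) $ n = gf (\<lambda>x. sz (f x)) (\<lambda>x. w (f x)) S $ n"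
    unfolding gf_nth by (simp only: sum.reindex o_def)
qed

lemma gf_Suc: "gf (\<lambda>x. Suc (sz x)) (\<lambda>x. c * w x) S = fps_X * fps_const c * gf sz w S"
proof (rule fps_ext)
  fix n
  show "gf (\<lambda>x. Suc (sz x)) (\<lambda>x. c * w x) S $ n = (fps_X * fps_const c * gf sz w S) $ n"
    by (cases n) (simp_all add: gf_nth mult.assoc sum_distrib_left)
qed

lemma gf_Times:
  assumes "\<And>n. finite {x. x \<in> S \<and> sz x = n}" "\<And>n. finite {x. x \<in> S' \<and> sz' x = n}"
  shows "gf (\<lambda>(x, y). sz x + sz' y) (\<lambda>(x, y). w x * w' y) (S \<times> S') = gf sz w S * gf sz' w' S'"
proof (rule fps_ext)
  fix n
  let ?B = "\<lambda>i. {x. x \<in> S \<and> sz x = i} \<times> {y. y \<in> S' \<and> sz' y = n - i}"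
  have "{p. p \<in> S \<times> S' \<and> (case p of (x, y) \<Rightarrow> sz x + sz' y) = n} = (\<Union>i \<in> {0..n}. ?B i)" by auto
  then have "gf (\<lambda>(x, y). sz x + sz' y) (\<lambda>(x, y). w x * w' y) (S \<times> S') $ n =
      (\<Sum>p \<in> (\<Union>i \<in> {0..n}. ?B i). case p of (x, y) \<Rightarrow> w x * w' y)"
    unfolding gf_nth by (simp only:)
  also have "\<dots> = (\<Sum>i = 0..n. \<Sum>p \<in> ?B i. case p of (x, y) \<Rightarrow> w x * w' y)"
    by (rule sum.UNION_disjoint) (use assms in auto)
  also have "\<dots> = (gf sz w S * gf sz' w' S') $ n"
    unfolding fps_mult_nth gf_nth sum_product sum.cartesian_product ..
  finally show "gf (\<lambda>(x, y). sz x + sz' y) (\<lambda>(x, y). w x * w' y) (S \<times> S') $ n =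
      (gf sz w S * gf sz' w' S') $ n" .
qed


section \<open>The quadratic equation for interior trees\<close>

lemma is_leaf_iff: "is_leaf s \<longleftrightarrow> s = Node []"
  by (cases s) (simp add: is_leaf_def)

section \<open>Contributions of the root to the leaf and edge statistics\<close>

lemma card_indices_Cons:
  "card {i. i < length (x # xs) \<and> P i} =
     (if P 0 then 1 else 0) + card {i. i < length xs \<and> P (Suc i)}"
proof -
  have "{i. i < length (x # xs) \<and> P i} =
      (if P 0 then {0} else {}) \<union> Suc ` {i. i < length xs \<and> P (Suc i)}"
    by (auto simp: less_Suc_eq_0_disj)
  moreover have "card (Suc ` {i. i < length xs \<and> P (Suc i)}) = card {i. i < length xs \<and> P (Suc i)}"
    by (rule card_image) simp
  ultimately show ?thesis by (simp add: card_insert_if)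
qed

lemma card_indices_nth:
  "card {i. i < length xs \<and> P (xs ! i)} = (\<Sum>x \<leftarrow> xs. if P x then 1 else 0)"
proof (induction xs)
  case (Cons x xs)
  show ?case unfolding card_indices_Cons using Cons.IH by simp
qed simp

lemma count_nonroot_two:
  "count_nonroot P (Node (Node [] # s # ss)) =
     (if P (Node [] # s # ss) 0 then 1 else 0) + (if P (Node [] # s # ss) 1 then 1 else 0) +
     card {i. i < length ss \<and> P (Node [] # s # ss) (Suc (Suc i))} +
     count_nonroot P s + (\<Sum>s \<leftarrow> ss. count_nonroot P s)"
  unfolding count_nonroot.simps card_indices_Cons by simp

text \<open>At the root, the type of a leaf depends only on its position (0, 1 or later) and on
  whether \<open>s\<close> is a leaf. The edge to the first leaf is not young; all other root edges
  are, which gives the 1 for \<open>s\<close> and for each tree of \<open>ss\<close>.\<close>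

lemma
  shows sleaf_Node: "sleaf (Node (Node [] # s # ss)) = sleaf s + (\<Sum>s \<leftarrow> ss. sleaf s)"
    and etleaf_Node: "etleaf (Node (Node [] # s # ss)) =
      (if is_leaf s then 1 else 0) + etleaf s + (\<Sum>s \<leftarrow> ss. etleaf s)"
    and entleaf_Node: "entleaf (Node (Node [] # s # ss)) =
      (if is_leaf s then 0 else 1) + entleaf s + (\<Sum>s \<leftarrow> ss. entleaf s)"
    and syleaf_Node: "syleaf (Node (Node [] # s # ss)) =
      (if is_leaf s then 1 else 0) + syleaf s + (\<Sum>s \<leftarrow> ss. syleaf s)"
    and yerleaf_Node: "yerleaf (Node (Node [] # s # ss)) =
      yerleaf s + (\<Sum>s \<leftarrow> ss. (if is_leaf s then 1 else 0) + yerleaf s)"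
    and yedge_Node: "yedge (Node (Node [] # s # ss)) =
      1 + yedge s + (\<Sum>s \<leftarrow> ss. 1 + yedge s)"
  unfolding sleaf_def etleaf_def entleaf_def syleaf_def yerleaf_def yedge_def count_nonroot_two
  by (simp_all add: singleton_leaf_def elder_twin_leaf_def elder_nontwin_leaf_def second_leaf_def
      younger_leaf_def young_edge_def is_leaf_iff sum_list_addf sum_list_Suc
      card_indices_nth[where P = "\<lambda>s. s = Node []"]
      del: count_nonroot.simps)

lemma finite_edges: "finite {T. T \<in> S \<and> edges T = n}"
  by (rule finite_subset[OF _ finite_edges_le[of n]]) auto

lemma finite_edges_Node: "finite {ts. ts \<in> S \<and> edges (Node ts) = n}"
proof (rule finite_imageD)
  show "finite (Node ` {ts. ts \<in> S \<and> edges (Node ts) = n})"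
    by (rule finite_subset[OF _ finite_edges[of UNIV n]]) auto
qed (auto intro: inj_onI)

section \<open>Decomposition of tip-augmented trees and forests\<close>

abbreviation tips :: "plane_tree set" where
  "tips \<equiv> {T. tip_augmented T}"

lemma lists_decomp: "lists S = {[]} \<union> (\<lambda>(s, ss). s # ss) ` (S \<times> lists S)"
proof (rule set_eqI)
  fix ts show "ts \<in> lists S \<longleftrightarrow> ts \<in> {[]} \<union> (\<lambda>(s, ss). s # ss) ` (S \<times> lists S)"
    by (cases ts) auto
qed

lemma interior_tips_decomp:
  "tips - {Node []} =
     {Node [Node []]} \<union> (\<lambda>(s, ss). Node (Node [] # s # ss)) ` (tips \<times> lists tips)"
  (is "_ = ?R")
proof (rule set_eqI)
  fix T
  obtain ts where T: "T = Node ts" by (cases T)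
  consider "ts = []" | s where "ts = [s]" | s s' ss where "ts = s # s' # ss"
    by (metis list.exhaust)
  then show "T \<in> tips - {Node []} \<longleftrightarrow> T \<in> ?R"
    by cases (auto simp: T is_leaf_iff in_lists_conv_set image_iff)
qed

locale tree_weight =
  fixes u1 u2 u3 v1 v2 t :: "'a::comm_ring_1"
begin

definition wt :: "plane_tree \<Rightarrow> 'a" where
  "wt T = u1 ^ sleaf T * u2 ^ etleaf T * u3 ^ entleaf T *
     v1 ^ yerleaf T * v2 ^ syleaf T * t ^ yedge T"

text \<open>The one-vertex tree is left out: as a child it is a leaf whose factor depends on its
  position, and \<open>M\<close> sums only over trees with at least one edge.\<close>

definition interior_gf :: "'a fps" where
  "interior_gf = gf edges wt (tips - {Node []})"

lemma M_eq_nth: "M n u1 u2 u3 v1 v2 t = interior_gf $ Suc n"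
proof -
  have "tip_augmented_trees (n + 1) = {T. T \<in> tips - {Node []} \<and> edges T = Suc n}"
    by (auto simp: tip_augmented_trees_def edges_def)
  then show ?thesis by (simp add: M_def interior_gf_def gf_nth wt_def)
qed

text \<open>The first leaf of a vertex contributes its factor \<open>u2\<close> or \<open>u3\<close> to the weight of the second
  child, because that child decides whether it is a twin.\<close>

definition second_wt :: "plane_tree \<Rightarrow> 'a" where
  "second_wt s = t * (if is_leaf s then u2 * v2 else u3 * wt s)"

text \<open>Meant for the children from the third on; \<open>t\<close> belongs to the young edge
  above the child.\<close>

definition younger_wt :: "plane_tree \<Rightarrow> 'a" where
  "younger_wt s = t * (if is_leaf s then v1 else wt s)"

definition forest_wt :: "plane_tree list \<Rightarrow> 'a" where
  "forest_wt ss = (\<Prod>s \<leftarrow> ss. younger_wt s)"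

lemma wt_leaf: "wt (Node []) = 1"
  by (simp add: wt_def sleaf_def etleaf_def entleaf_def syleaf_def yerleaf_def yedge_def)

lemma wt_single: "wt (Node [Node []]) = u1"
proof -
  have "{i. i < Suc 0 \<and> P i} = (if P 0 then {0} else {})" for P by auto
  then show ?thesis
    by (simp add: wt_def sleaf_def etleaf_def entleaf_def syleaf_def yerleaf_def yedge_def
        singleton_leaf_def elder_twin_leaf_def elder_nontwin_leaf_def second_leaf_def
        younger_leaf_def young_edge_def is_leaf_iff)
qed

lemma forest_wt_eq:
  "forest_wt ss = u1 ^ (\<Sum>s \<leftarrow> ss. sleaf s) * u2 ^ (\<Sum>s \<leftarrow> ss. etleaf s) *
     u3 ^ (\<Sum>s \<leftarrow> ss. entleaf s) * v1 ^ (\<Sum>s \<leftarrow> ss. (if is_leaf s then 1 else 0) + yerleaf s) *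
     v2 ^ (\<Sum>s \<leftarrow> ss. syleaf s) * t ^ (\<Sum>s \<leftarrow> ss. 1 + yedge s)"
proof (induction ss)
  case Nil
  then show ?case by (simp add: forest_wt_def)
next
  case (Cons s ss)
  \<comment> \<open>Because a leaf has weight 1, both cases merge into one product of
    powers.\<close>
  have "younger_wt s = t * (v1 ^ (if is_leaf s then 1 else 0) * wt s)"
    by (simp add: younger_wt_def is_leaf_iff wt_leaf)
  moreover have "forest_wt (s # ss) = younger_wt s * forest_wt ss"
    by (simp add: forest_wt_def)
  ultimately show ?case
    by (simp add: Cons.IH wt_def power_add mult_ac)
qed

lemma wt_Node: "wt (Node (Node [] # s # ss)) = second_wt s * forest_wt ss"
proof -
  have "second_wt s = t * (u2 ^ (if is_leaf s then 1 else 0) * u3 ^ (if is_leaf s then 0 else 1) *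
      v2 ^ (if is_leaf s then 1 else 0) * wt s)"
    by (simp add: second_wt_def is_leaf_iff wt_leaf)
  then show ?thesis
    unfolding wt_def sleaf_Node etleaf_Node entleaf_Node syleaf_Node yerleaf_Node yedge_Node
      forest_wt_eq
    by (simp add: power_add mult_ac)
qed

text \<open>Common form of the two child series: \<open>a = u2 * v2\<close>, \<open>b = u3\<close>
  for a second child, \<open>a = v1\<close>, \<open>b = 1\<close> for a younger one.\<close>

lemma gf_child:
  "gf (\<lambda>s. Suc (edges s)) (\<lambda>s. t * (if is_leaf s then a else b * wt s)) tips =
     fps_X * fps_const t * (fps_const a + fps_const b * interior_gf)"
proof -
  let ?w = "\<lambda>s. if is_leaf s then a else b * wt s"
  have "tips = {Node []} \<union> (tips - {Node []})" by auto
  then have "gf edges ?w tips = gf edges ?w ({Node []} \<union> (tips - {Node []}))"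
    by (rule arg_cong)
  also have "\<dots> = gf edges ?w {Node []} + gf edges ?w (tips - {Node []})"
    by (rule gf_Un) (rule finite_edges, rule finite_edges, simp)
  also have "gf edges ?w {Node []} = fps_const a"
    by (simp add: gf_singleton is_leaf_iff edges_def)
  also have "gf edges ?w (tips - {Node []}) = gf edges (\<lambda>s. b * wt s) (tips - {Node []})"
    by (rule gf_cong) (auto simp: is_leaf_iff)
  also have "\<dots> = fps_const b * interior_gf"
    by (rule fps_ext) (simp add: gf_nth interior_gf_def sum_distrib_left)
  finally show ?thesis unfolding gf_Suc by (simp only:)
qed

text \<open>The size includes the edges from a common parent to the roots of the forest.\<close>

definition forest_gf :: "'a fps" where
  "forest_gf = gf (\<lambda>ss. edges (Node ss)) forest_wt (lists tips)"

lemma forest_gf_eq: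
  "forest_gf = 1 + fps_X * fps_const t * (fps_const v1 + interior_gf) * forest_gf"
proof -
  let ?c = "\<lambda>(s, ss). s # ss"
  have "forest_gf = gf (\<lambda>ss. edges (Node ss)) forest_wt ({[]} \<union> ?c ` (tips \<times> lists tips))"
    unfolding forest_gf_def by (subst lists_decomp) simp
  also have "\<dots> = gf (\<lambda>ss. edges (Node ss)) forest_wt {[]} +
      gf (\<lambda>ss. edges (Node ss)) forest_wt (?c ` (tips \<times> lists tips))"
    by (rule gf_Un) (auto intro: finite_edges_Node)
  also have "gf (\<lambda>ss. edges (Node ss)) forest_wt {[]} = 1"
    by (simp add: gf_singleton forest_wt_def edges_def)
  also have "gf (\<lambda>ss. edges (Node ss)) forest_wt (?c ` (tips \<times> lists tips)) =
      gf (\<lambda>p. edges (Node (?c p))) (\<lambda>p. forest_wt (?c p)) (tips \<times> lists tips)"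
    by (rule gf_image) (auto intro: inj_onI)
  also have "\<dots> = gf (\<lambda>(s, ss). Suc (edges s) + edges (Node ss))
      (\<lambda>(s, ss). younger_wt s * forest_wt ss) (tips \<times> lists tips)"
    by (rule gf_cong) (auto simp: edges_Node forest_wt_def)
  also have "\<dots> = gf (\<lambda>s. Suc (edges s)) younger_wt tips * forest_gf"
    unfolding forest_gf_def
  proof (rule gf_Times)
    show "finite {x. x \<in> tips \<and> Suc (edges x) = n}" for n
      by (rule finite_subset[OF _ finite_edges[of tips "n - 1"]]) auto
  qed (rule finite_edges_Node)
  also have "gf (\<lambda>s. Suc (edges s)) younger_wt tips =
      fps_X * fps_const t * (fps_const v1 + interior_gf)"
    using gf_child[of v1 1] by (simp add: younger_wt_def[abs_def] cong: if_cong)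
  finally show ?thesis .
qed

lemma interior_gf_eq:
  "interior_gf = fps_X * fps_const u1 +
     fps_X * (fps_X * fps_const t * (fps_const (u2 * v2) + fps_const u3 * interior_gf)) * forest_gf"
proof -
  let ?c = "\<lambda>(s, ss). Node (Node [] # s # ss)"
  have "interior_gf = gf edges wt ({Node [Node []]} \<union> ?c ` (tips \<times> lists tips))"
    unfolding interior_gf_def interior_tips_decomp ..
  also have "\<dots> = gf edges wt {Node [Node []]} + gf edges wt (?c ` (tips \<times> lists tips))"
    by (rule gf_Un) (auto intro: finite_edges)
  also have "gf edges wt {Node [Node []]} = fps_X * fps_const u1"
    by (simp add: gf_singleton wt_single edges_Node mult.commute)
  also have "gf edges wt (?c ` (tips \<times> lists tips)) =
      gf (\<lambda>p. edges (?c p)) (\<lambda>p. wt (?c p)) (tips \<times> lists tips)"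
    by (rule gf_image) (auto intro: inj_onI)
  \<comment> \<open>The outer \<open>Suc\<close> is the edge to the first leaf. Its factor
    \<open>u2\<close> or \<open>u3\<close> is already part of \<open>second_wt\<close>, hence the
    weight 1 in the shape required by \<open>gf_Suc\<close>.\<close>
  also have "\<dots> = gf (\<lambda>p. Suc (case p of (s, ss) \<Rightarrow> Suc (edges s) + edges (Node ss)))
      (\<lambda>p. 1 * (case p of (s, ss) \<Rightarrow> second_wt s * forest_wt ss)) (tips \<times> lists tips)"
    by (rule gf_cong) (auto simp: edges_Node wt_Node)
  also have "\<dots> = fps_X * gf (\<lambda>(s, ss). Suc (edges s) + edges (Node ss))
      (\<lambda>(s, ss). second_wt s * forest_wt ss) (tips \<times> lists tips)"
    unfolding gf_Suc by simp
  also have "gf (\<lambda>(s, ss). Suc (edges s) + edges (Node ss))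
      (\<lambda>(s, ss). second_wt s * forest_wt ss) (tips \<times> lists tips) =
      gf (\<lambda>s. Suc (edges s)) second_wt tips * forest_gf"
    unfolding forest_gf_def
  proof (rule gf_Times)
    show "finite {x. x \<in> tips \<and> Suc (edges x) = n}" for n
      by (rule finite_subset[OF _ finite_edges[of tips "n - 1"]]) auto
  qed (rule finite_edges_Node)
  also have "gf (\<lambda>s. Suc (edges s)) second_wt tips =
      fps_X * fps_const t * (fps_const (u2 * v2) + fps_const u3 * interior_gf)"
    using gf_child[of "u2 * v2" u3] by (simp add: second_wt_def[abs_def])
  finally show ?thesis by (simp only: mult.assoc)
qed

text \<open>The forest series is geometric, the inverse of \<open>1 - ?Y\<close> with
  \<open>?Y\<close> the series of a single younger child; multiplying by \<open>1 - ?Y\<close>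
  eliminates it.\<close>

lemma interior_gf_quadratic:
  "(interior_gf - fps_X * fps_const u1) *
     (1 - fps_X * fps_const t * (fps_const v1 + interior_gf)) =
   fps_X * (fps_X * fps_const t * (fps_const (u2 * v2) + fps_const u3 * interior_gf))"
  (is "(?A - ?U) * (1 - ?Y) = fps_X * ?S")
proof -
  have L: "forest_gf * (1 - ?Y) = 1"
    unfolding right_diff_distrib diff_eq_eq
    using forest_gf_eq by (simp only: mult_1_right mult.commute[of forest_gf])
  have "?A - ?U = fps_X * ?S * forest_gf"
    unfolding diff_eq_eq by (subst add.commute) (rule interior_gf_eq)
  then have "(?A - ?U) * (1 - ?Y) = fps_X * ?S * (forest_gf * (1 - ?Y))"
    by (simp only: mult.assoc)
  then show ?thesis by (simp only: L mult_1_right)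
qed

end


section \<open>Coefficientwise derivations of power series\<close>

definition fps_map :: "('a \<Rightarrow> 'b) \<Rightarrow> 'a::zero fps \<Rightarrow> 'b::zero fps" where
  "fps_map f p = Abs_fps (\<lambda>n. f (p $ n))"

lemma fps_map_nth [simp]: "fps_map f p $ n = f (p $ n)"
  by (simp add: fps_map_def)

text \<open>Two instances share these rules when the quadratic equation is differentiated: the
  coefficientwise extension \<open>fps_map D\<close> and \<open>fps_deriv\<close>.\<close>

locale derivation =
  fixes D :: "'a::comm_ring_1 \<Rightarrow> 'a"
  assumes add: "D (p + q) = D p + D q"
    and mult: "D (p * q) = D p * q + p * D q"
begin

lemma zero: "D 0 = 0"
  using add[of 0 0] by simp

lemma one: "D 1 = 0"
  using mult[of 1 1] by simp

lemma uminus: "D (- p) = - D p"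
  using add[of p "- p"] by (simp add: zero eq_neg_iff_add_eq_0 add.commute)

lemma diff: "D (p - q) = D p - D q"
  using add[of p "- q"] by (simp add: uminus)

lemma sum: "D (\<Sum>x \<in> S. f x) = (\<Sum>x \<in> S. D (f x))"
  by (induction S rule: infinite_finite_induct) (simp_all add: zero add)

lemma of_nat_mult: "D (of_nat k * p) = of_nat k * D p"
  by (induction k) (simp_all add: zero add distrib_right)

lemma derivation_fps_map: "derivation (fps_map D)"
proof
  fix p q
  show "fps_map D (p + q) = fps_map D p + fps_map D q"
    by (rule fps_ext) (simp add: add)
  show "fps_map D (p * q) = fps_map D p * q + p * fps_map D q"
    by (rule fps_ext) (simp add: fps_mult_nth sum mult sum.distrib)
qed

lemma fps_map_X: "fps_map D fps_X = 0"
  by (rule fps_ext) (simp add: fps_X_def zero one)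

lemma fps_map_const: "fps_map D (fps_const c) = fps_const (D c)"
  by (rule fps_ext) (simp add: zero)

end

lemma derivation_fps_deriv: "derivation fps_deriv"
  by standard simp_all

text \<open>The coefficient ring may have zero divisors, so \<open>f\<close> is cancelled through
  its inverse series, which exists because the constant term is a unit.\<close>

lemma fps_mult_eq_0_of_unit:
  fixes f g :: "'a::comm_ring_1 fps"
  assumes "f * g = 0" "f $ 0 * c = 1"
  shows "g = 0"
  using fps_right_inverse[OF assms(2)] assms(1)
  by (metis mult.assoc mult.commute mult_1 mult_zero_right)


section \<open>The recurrence\<close>

locale grammar_derivation = derivation D + tree_weight u1 u2 u3 v1 v2 t
  for D :: "'a::comm_ring_1 \<Rightarrow> 'a" and u1 u2 u3 v1 v2 t :: 'a +
  fixes u2' :: 'a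
  assumes inv: "u2 * u2' = 1"
    and D_u1: "D u1 = 3 * t * u2 * v2"
    and D_u2: "D u2 = 3 * t * u2 * v1"
    and D_u3: "D u3 = 3 * t * u2 * v2"
    and D_v1: "D v1 = 2 * (u1 + u3)"
    and D_v2: "D v2 = 4 * u1 * u2' * u3"
    and D_t: "D t = t ^ 2 * v1"
begin

text \<open>The quadratic equation contains \<open>u2\<close> and \<open>v2\<close> only through
  their product, and in the derivative of this product \<open>u2'\<close> cancels.\<close>

lemma D_u2_v2: "D (u2 * v2) = 3 * t * v1 * (u2 * v2) + 4 * u1 * u3"
proof -
  have "D (u2 * v2) = 3 * t * v1 * (u2 * v2) + 4 * u1 * u3 * (u2 * u2')"
    unfolding mult D_u2 D_v2 by (simp add: mult_ac)
  then show ?thesis by (simp add: inv)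
qed

text \<open>The factor \<open>fps_X\<close> throughout clears the denominator of
  \<open>A / X\<close>.\<close>

lemma fps_map_D_interior_gf:
  "fps_X * fps_map D interior_gf =
     fps_X * fps_deriv interior_gf + interior_gf - 2 * fps_X * fps_const u1"
proof -
  interpret d: derivation "fps_map D" by (rule derivation_fps_map)
  interpret e: derivation "fps_deriv :: 'a fps \<Rightarrow> 'a fps" by (rule derivation_fps_deriv)
  \<comment> \<open>Opaque names make \<open>cofactors\<close> below an identity between polynomials
    in independent indeterminates.\<close>
  define A B C where "A = interior_gf" and "B = fps_map D interior_gf"
    and "C = fps_deriv interior_gf"
  define X U U' V T P where "X = (fps_X :: 'a fps)" and "U = fps_const u1" and "U' = fps_const u3"
    and "V = fps_const v1" and "T = fps_const t" and "P = fps_const (u2 * v2)"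
  note defs = A_def B_def C_def X_def U_def U'_def V_def T_def P_def
  have dU: "fps_map D U = 3 * T * P" and dU': "fps_map D U' = 3 * T * P"
    and dV: "fps_map D V = 2 * (U + U')" and dT: "fps_map D T = T ^ 2 * V"
    and dP: "fps_map D P = 3 * T * V * P + 4 * U * U'"
    unfolding defs fps_map_const D_u1 D_u3 D_v1 D_t D_u2_v2
    by (simp_all flip: fps_const_mult fps_const_add fps_const_power numeral_fps_const add: mult.assoc)
  have dX: "fps_map D X = 0" and dA: "fps_map D A = B"
    by (simp_all add: defs fps_map_X)
  have e: "fps_deriv U = 0" "fps_deriv U' = 0" "fps_deriv V = 0" "fps_deriv T = 0"
    "fps_deriv P = 0" "fps_deriv X = 1" "fps_deriv A = C"
    by (simp_all add: defs)
  have Q: "(A - X * U) * (1 - X * T * (V + A)) = X * (X * T * (P + U' * A))"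
    (is "?l = ?r")
    using interior_gf_quadratic by (simp only: defs)
  \<comment> \<open>\<open>dQ\<close> is affine in \<open>B\<close> and \<open>eQ\<close> is affine
    in \<open>C\<close>, both with the partial derivative of \<open>?l - ?r\<close> in
    \<open>A\<close> as coefficient, so their difference is affine in \<open>B - C\<close>.\<close>
  have dQ: "(B - X * (3 * T * P)) * (1 - X * T * (V + A)) -
      (A - X * U) * (X * (T ^ 2 * V * (V + A) + T * (2 * (U + U') + B))) =
      X * (X * (T ^ 2 * V * (P + U' * A) +
        T * (3 * T * V * P + 4 * U * U' + 3 * T * P * A + U' * B)))"
    (is "?dl = ?dr")
    using arg_cong[OF Q, of "fps_map D"]
    unfolding d.mult d.add d.diff d.one dU dU' dV dT dP dX dA by (simp add: algebra_simps)
  have eQ: "(C - U) * (1 - X * T * (V + A)) - (A - X * U) * (T * (V + A) + X * T * C) =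
      2 * X * T * (P + U' * A) + X * X * T * U' * C"
    (is "?el = ?er")
    using arg_cong[OF Q, of fps_deriv]
    unfolding e.mult e.add e.diff e.one e by (simp add: algebra_simps)
  \<comment> \<open>\<open>?Q_A\<close> is the partial derivative of \<open>?r - ?l\<close> in
    \<open>A\<close>. In \<open>cofactors\<close>, the terms free of \<open>B\<close> and
    \<open>C\<close> combine to a multiple of \<open>?l - ?r\<close>, and
    \<open>1 + X * T * V\<close> is the quotient.\<close>
  let ?Q_A = "2 * X * T * A - 1 + X * T * V - X * X * T * (U - U')"
  have cofactors: "?Q_A * (X * B - X * C - A + 2 * X * U) =
      (1 + X * T * V) * (?l - ?r) - X * ((?dl - ?dr) - (?el - ?er))"
    by (simp add: algebra_simps power2_eq_square)
  have "?Q_A * (X * B - X * C - A + 2 * X * U) = 0"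
    unfolding cofactors using Q dQ eQ by simp
  moreover have "?Q_A $ 0 * - 1 = 1"
    by (simp add: X_def mult.assoc)
  ultimately have "X * B - X * C - A + 2 * X * U = 0"
    by (rule fps_mult_eq_0_of_unit)
  then show ?thesis by (simp add: defs algebra_simps)
qed

lemma D_M: "D (M n u1 u2 u3 v1 v2 t) = of_nat (n + 3) * M (Suc n) u1 u2 u3 v1 v2 t"
proof -
  \<comment> \<open>\<open>M n\<close> is the coefficient at \<open>n + 1\<close>, hence at
    \<open>n + 2\<close> after multiplication by \<open>fps_X\<close>. There the derivative term
    gives the factor \<open>n + 2\<close>, \<open>interior_gf\<close> adds one more, and the
    correction with \<open>u1\<close>, which lives at index 1, vanishes.\<close>
  have "(fps_X * fps_map D interior_gf) $ Suc (Suc n) =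
      (fps_X * fps_deriv interior_gf + interior_gf - 2 * fps_X * fps_const u1) $ Suc (Suc n)"
    by (simp only: fps_map_D_interior_gf)
  then show ?thesis
    by (simp add: M_eq_nth mult.assoc numeral_fps_const algebra_simps)
qed

text \<open>Turns \<open>D_M\<close> at 0 into a formula for \<open>D u1\<close>, the base of the
  induction below.\<close>

lemma M_0: "M 0 u1 u2 u3 v1 v2 t = u1"
proof -
  have "interior_gf $ 1 = u1"
    unfolding arg_cong[OF interior_gf_eq, of "\<lambda>f. f $ 1"] fps_add_nth mult.assoc fps_X_mult_nth
    by simp
  then show ?thesis by (simp add: M_eq_nth)
qed

text \<open>At exponent 0 the formula would give \<open>2 * u1\<close> in place of
  \<open>2 * u3\<close>; the two have the same derivative, so it holds from exponent 1 on. Each use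
  of \<open>D_M\<close> supplies the next factor of the factorial.\<close>

lemma funpow_D:
  "(D ^^ Suc n) (2 * u3) = of_nat (fact (Suc n + 2)) * M (Suc n) u1 u2 u3 v1 v2 t"
proof (induction n)
  case 0
  have "D u3 = 3 * M 1 u1 u2 u3 v1 v2 t"
    using D_M[of 0] by (simp add: M_0 D_u1 D_u3)
  then show ?case using of_nat_mult[of 2 u3] by (simp add: fact_numeral)
next
  case (Suc n)
  have "(D ^^ Suc (Suc n)) (2 * u3) =
      of_nat (fact (Suc n + 2)) * (of_nat (Suc n + 3) * M (Suc (Suc n)) u1 u2 u3 v1 v2 t)"
    by (simp only: funpow.simps o_apply Suc.IH[unfolded funpow.simps o_apply] of_nat_mult D_M)
  also have "\<dots> = of_nat (fact (Suc (Suc n) + 2)) * M (Suc (Suc n)) u1 u2 u3 v1 v2 t"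
    by (simp add: algebra_simps)
  finally show ?case .
qed

end

section \<open>Specialization to the Laurent polynomial ring\<close>

theorem theorem4p1:
  fixes D :: "laurent \<Rightarrow> laurent" and n :: nat
  assumes "formal_derivative grammar D"
    and "n \<ge> 1"
  shows "(D ^^ n) (2 * var_u3) =
    fact (n + 2) * M n var_u1 var_u2 var_u3 var_v1 var_v2 var_t"
proof -
  have add: "D (p + q) = D p + D q" and mult: "D (p * q) = D p * q + p * D q" for p q
    using assms(1) unfolding formal_derivative_def by blast+
  have rules: "\<forall>(z, f) \<in> grammar. D z = f"
    using assms(1) unfolding formal_derivative_def by (elim conjE)
  interpret grammar_derivation D var_u1 var_u2 var_u3 var_v1 var_v2 var_t var_u2_inv
    by unfold_locales (use rules in \<open>simp_all add: add mult grammar_def var_u2_mult_inv\<close>)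
  obtain m where m: "n = Suc m"
    using assms(2) by (cases n) auto
  show ?thesis
    unfolding m funpow_D of_nat_fact ..
qed

end
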